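(* Let $\alpha>0$, $f\in F_\alpha^2$, and let $n\ge1$ be an integer. Put $T_n(f,0)(w)=\sum_{k=0}^{n-1}\frac{f^{(k)}(0)}{k!}w^k$. Then for every $z\in\mathbb{C}$ the following sharp inequality holds: $$|f^{(n)}(z)|\le\sqrt{\alpha^n\,\Gamma(1+n)\,{}_1F_1(1+n;1;\alpha|z|^2)}\;\|f-T_n(f,0)\|_{2,\alpha}.$$ For each given $z\in\mathbb{C}$, equality at $z$ is attained by the extremal function $f(w)=\alpha^n e^{\alpha\bar z w}w^n$. Consequently, for every $z\in\mathbb{C}$, $$|f^{(n)}(z)|\le\sqrt{\alpha^n\,\Gamma(1+n)\,{}_1F_1(1+n;1;\alpha|z|^2)}\;\inf_{P\in\mathcal{P}_n}\|f-P\|_{2,\alpha},$$ where $\mathcal{P}_n$ is the set of all (analytic) polynomials of degree at most $n-1$. In particular, for $n=1$ the following best possible estimates hold: $$|f'(z)|\le\sqrt{\alpha(1+\alpha|z|^2)}\,e^{\alpha|z|^2/2}\,\|f(\cdot)-f(0)\|_{2,\alpha}\le\sqrt{\alpha(1+\alpha|z|^2)}\,e^{\alpha|z|^2/2}\,\|f\|_{2,\alpha}.$$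
   Context: For $\alpha>0$, $\|f\|_{2,\alpha}^2=\frac{\alpha}{\pi}\int_{\mathbb{C}}|f(z)|^2e^{-\alpha|z|^2}\,dA(z)$, where $dA$ is Lebesgue measure on $\mathbb{C}$. The Fock space $F_\alpha^2$ is the space of all entire functions $f$ with $\|f\|_{2,\alpha}<\infty$. ${}_1F_1(a;b;x)=\sum_{k\ge0}\frac{(a)_k}{(b)_k}\frac{x^k}{k!}$ is Kummer's confluent hypergeometric function, with $(a)_k=a(a+1)\cdots(a+k-1)$. $f^{(k)}$ denotes the $k$-th complex derivative. *)

theory Defs
  imports "HOL-Complex_Analysis.Complex_Analysis" "HOL-Computational_Algebra.Polynomial"
begin

definition fock_integrand :: "real \<Rightarrow> (complex \<Rightarrow> complex) \<Rightarrow> complex \<Rightarrow> real" where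
  "fock_integrand \<alpha> f z = (cmod (f z))\<^sup>2 * exp (- \<alpha> * (cmod z)\<^sup>2)"

text \<open>The Bochner integral is 0 on non-integrable functions, so
  \<open>fock_norm \<alpha> f\<close> is meaningful only when \<open>fock_integrand \<alpha> f\<close> is integrable; this
  integrability is how finiteness of the norm is expressed in \<open>fock_space\<close>.\<close>

definition fock_norm :: "real \<Rightarrow> (complex \<Rightarrow> complex) \<Rightarrow> real" where
  "fock_norm \<alpha> f = sqrt (\<alpha> / pi * (LINT z|lborel. fock_integrand \<alpha> f z))"

definition fock_space :: "real \<Rightarrow> (complex \<Rightarrow> complex) set" where
  "fock_space \<alpha> = {f. f holomorphic_on UNIV \<and> integrable lborel (fock_integrand \<alpha> f)}"

definition kummer_1F1 :: "real \<Rightarrow> real \<Rightarrow> real \<Rightarrow> real" where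
  "kummer_1F1 a b x = (\<Sum>k. pochhammer a k / pochhammer b k * (x ^ k / fact k))"

definition taylor0 :: "nat \<Rightarrow> (complex \<Rightarrow> complex) \<Rightarrow> complex \<Rightarrow> complex" where
  "taylor0 n f w = (\<Sum>k<n. (deriv ^^ k) f 0 / fact k * w ^ k)"

definition fock_const :: "real \<Rightarrow> nat \<Rightarrow> complex \<Rightarrow> real" where
  "fock_const \<alpha> n z =
     sqrt (\<alpha> ^ n * Gamma (1 + real n) * kummer_1F1 (1 + real n) 1 (\<alpha> * (cmod z)\<^sup>2))"

definition fock_extremal :: "real \<Rightarrow> nat \<Rightarrow> complex \<Rightarrow> complex \<Rightarrow> complex" where
  "fock_extremal \<alpha> n z w = of_real (\<alpha> ^ n) * exp (of_real \<alpha> * cnj z * w) * w ^ n"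

end

theory Submission
  imports Defs "HOL-Probability.Distributions"
begin

text \<open>
  Averaging \<open>\<bar>f\<bar>\<^sup>2\<close> over the rotations by \<open>N\<close>-th roots of unity leaves its integral against a radial
  weight unchanged and, as \<open>N\<close> tends to infinity, removes the off-diagonal products of Taylor
  coefficients. Fatou's lemma then yields, for every entire \<open>f\<close> with Taylor coefficients \<open>a\<^sub>k\<close>,
  \<open>\<parallel>f\<parallel>\<^sup>2 = (\<Sum>k. \<bar>a\<^sub>k\<bar>\<^sup>2 k! / \<alpha>\<^sup>k)\<close>, both sides being possibly infinite. Since \<open>f\<^sup>(\<^sup>n\<^sup>)(z)\<close> is a linear
  functional of the \<open>a\<^sub>k\<close> with \<open>k \<ge> n\<close>, and subtracting a polynomial of degree less than \<open>n\<close> does not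
  affect these, the Cauchy-Schwarz inequality gives all the estimates; the extremal function is the
  one whose coefficients are proportional to those of the functional.
\<close>

unbundle no fps_syntax

subsection \<open>Rotations and radial functions in the plane\<close>

text \<open>Lebesgue measure is determined by its values on open boxes, and identifying the plane
  with \<open>real^2\<close> pulls a box back to a box with the same side lengths. This carries
  facts about orthogonal maps over to \<open>complex\<close>.\<close>

lemma distr_lborel_Complex:
  "distr (lborel :: (real^2) measure) borel (\<lambda>v. Complex (v $ 1) (v $ 2)) = lborel"
proof (rule lborel_eqI[symmetric])
  have meas [measurable]: "(\<lambda>v::real^2. Complex (v $ 1) (v $ 2)) \<in> borel_measurable borel"
    by (intro borel_measurable_continuous_onI) (auto simp: complex_eq_iff Complex_eq intro!: continuous_intros)
  fix l u :: complex
  assume lu: "\<And>b. b \<in> Basis \<Longrightarrow> l \<bullet> b \<le> u \<bullet> b"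
  define l' u' :: "real^2" where "l' = vector [Re l, Im l]" and "u' = vector [Re u, Im u]"
  have "(\<lambda>v::real^2. Complex (v $ 1) (v $ 2)) -` box l u = box l' u'"
    by (auto simp: box_def Basis_complex_def Basis_vec_def inner_axis l'_def u'_def forall_2)
  moreover have "(\<Prod>b\<in>Basis. (u' - l') \<bullet> b) = (\<Prod>b\<in>Basis. (u - l) \<bullet> b)"
    by (simp add: Basis_complex_def Basis_vec_def inner_axis l'_def u'_def UNION_singleton_eq_range
        prod.reindex inj_on_def axis_eq_axis prod_2 UNIV_2 axis_eq_axis)
  moreover have "l' \<bullet> b \<le> u' \<bullet> b" if bas: "b \<in> Basis" for b
  proof -
    obtain i where b: "b = axis i 1" using bas by (auto simp: Basis_vec_def)
    show ?thesis using exhaust_2[of i] lu[of 1] lu[of \<i>]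
      by (auto simp: b Basis_complex_def inner_axis l'_def u'_def)
  qed
  ultimately show "emeasure (distr lborel borel (\<lambda>v::real^2. Complex (v $ 1) (v $ 2))) (box l u) = (\<Prod>b\<in>Basis. (u - l) \<bullet> b)"
    by (subst emeasure_distr) auto
qed auto

text \<open>The library has invariance of measure under orthogonal maps only for \<open>real ^ 'n\<close>.\<close>

lemma distr_lborel_rotation:
  fixes c :: complex
  assumes c: "cmod c = 1"
  shows "distr lborel borel ((*) c) = lborel"
proof (rule lborel_eqI[symmetric])
  define \<phi> where "\<phi> = (\<lambda>v::real^2. Complex (v $ 1) (v $ 2))"
  define \<psi> where "\<psi> = (\<lambda>z. vector [Re z, Im z] :: real^2)"
  have \<phi>\<psi>: "\<phi> (\<psi> z) = z" "\<psi> (\<phi> v) = v" for z v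
    by (auto simp: \<phi>_def \<psi>_def vec_eq_iff forall_2)
  have bl: "bounded_linear \<phi>"
    unfolding \<phi>_def Complex_eq
    by (intro bounded_linear_intros bounded_linear_compose[OF bounded_linear_of_real]
        bounded_linear_vec_nth)
  have norm\<phi>: "cmod (\<phi> v) = norm v" for v
    by (simp add: \<phi>_def norm_vec_def L2_set_def sum_2 cmod_def)
  have meas [measurable]: "\<phi> \<in> borel_measurable borel"
    by (intro borel_measurable_continuous_onI linear_continuous_on bl)
  have lborel_\<phi>: "distr lborel borel \<phi> = lborel"
    unfolding \<phi>_def by (rule distr_lborel_Complex)
  have em: "emeasure lborel S = emeasure lborel (\<phi> -` S)" if "S \<in> sets borel" for S
  proof -
    have "emeasure lborel S = emeasure (distr lborel borel \<phi>) S"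
      by (simp add: lborel_\<phi>)
    also have "\<dots> = emeasure lborel (\<phi> -` S)"
      using that by (subst emeasure_distr) auto
    finally show ?thesis .
  qed
  have lin: "linear \<phi>" by (rule bounded_linear.linear[OF bl])
  have lin\<psi>: "linear \<psi>"
    by (rule linearI) (auto simp: \<psi>_def vec_eq_iff forall_2)
  \<comment> \<open>\<open>R\<close> is multiplication by \<open>c\<close> read in the coordinates
    of \<open>real^2\<close>; it is linear and, as \<open>cmod c = 1\<close>,
    norm-preserving.\<close>
  define R where "R = (\<lambda>v. \<psi> (c * \<phi> v))"
  have ortho: "orthogonal_transformation R"
    unfolding orthogonal_transformation
  proof (intro conjI allI)
    show "linear R"
      unfolding R_def using linear_compose[OF linear_compose[OF lin, of "(*) c"] lin\<psi>]
      by (simp add: o_def bounded_linear.linear[OF bounded_linear_mult_right])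
    show "norm (R v) = norm v" for v
      using c by (simp add: R_def flip: norm\<phi>) (simp add: \<phi>\<psi> norm_mult)
  qed
  fix l u :: complex
  assume lu: "\<And>b. b \<in> Basis \<Longrightarrow> l \<bullet> b \<le> u \<bullet> b"
  define S where "S = (*) c -` box l u"
  have S: "S \<in> sets borel" unfolding S_def
    by (rule measurable_sets_borel[where M=borel]) (auto intro!: borel_measurable_continuous_onI continuous_intros)
  have "R ` (\<phi> -` S) = \<phi> -` box l u"
  proof (intro equalityI subsetI)
    fix v assume "v \<in> \<phi> -` box l u"
    moreover have "v = R (\<psi> (\<phi> v / c))"
      using c by (auto simp: R_def \<phi>\<psi>)
    moreover have "c * (\<phi> v / c) = \<phi> v" using c by auto
    ultimately show "v \<in> R ` (\<phi> -` S)"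
      by (intro image_eqI[of _ _ "\<psi> (\<phi> v / c)"]) (auto simp: S_def \<phi>\<psi>)
  qed (auto simp: R_def S_def \<phi>\<psi>)
  moreover have \<phi>S: "\<phi> -` S \<in> sets borel" 
    using S by (intro measurable_sets_borel[OF meas])
  \<comment> \<open>The invariance result for orthogonal images concerns sets of finite measure.
    Finiteness follows from boundedness: the coordinate map and multiplication by \<open>c\<close>
    both preserve norms, and the box is bounded.\<close>
  moreover have "\<phi> -` S \<in> lmeasurable"
  proof (rule bounded_set_imp_lmeasurable)
    obtain B where B: "\<And>x. x \<in> box l u \<Longrightarrow> norm x \<le> B"
      using bounded_box[of l u] by (auto simp: bounded_iff)
    have "norm v \<le> B" if "v \<in> \<phi> -` S" for v
      using that B[of "c * \<phi> v"] c by (auto simp: S_def norm_mult norm\<phi>)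
    thus "bounded (\<phi> -` S)" by (auto simp: bounded_iff)
    show "\<phi> -` S \<in> sets lebesgue" using \<phi>S by auto
  qed
  ultimately have *: "\<phi> -` box l u \<in> lmeasurable" 
      "measure lebesgue (\<phi> -` box l u) = measure lebesgue (\<phi> -` S)"
    using measurable_orthogonal_image[OF ortho] measure_orthogonal_image[OF ortho] by metis+
  have bx: "\<phi> -` box l u \<in> sets borel" by (intro measurable_sets_borel[OF meas]) auto
  have "emeasure lborel (\<phi> -` box l u) = emeasure lborel (\<phi> -` S)"
  proof -
    have "emeasure lebesgue (\<phi> -` box l u) = emeasure lebesgue (\<phi> -` S)"
      using * \<open>\<phi> -` S \<in> lmeasurable\<close> by (simp add: emeasure_eq_measure2)
    thus ?thesis using \<phi>S bx by simp
  qed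
  moreover have "(\<lambda>x. c * x) \<in> borel_measurable borel"
    by measurable
  ultimately show "emeasure (distr lborel borel ((*) c)) (box l u) = (\<Prod>b\<in>Basis. (u - l) \<bullet> b)"
    using S lu em[of "box l u"] em[OF S] by (subst emeasure_distr) (auto simp flip: S_def)
qed auto

lemma nn_integral_lborel_rotation:
  assumes [measurable]: "F \<in> borel_measurable borel" and "cmod c = 1"
  shows "(\<integral>\<^sup>+z. F (c * z) \<partial>lborel) = (\<integral>\<^sup>+z. F z \<partial>lborel)"
proof -
  have [measurable]: "(*) c \<in> borel_measurable borel" by measurable
  have "(\<integral>\<^sup>+z. F z \<partial>lborel) = (\<integral>\<^sup>+z. F z \<partial>distr lborel borel ((*) c))"
    using assms by (simp add: distr_lborel_rotation)
  also have "\<dots> = (\<integral>\<^sup>+z. F (c * z) \<partial>lborel)"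
    by (subst nn_integral_distr) auto
  finally show ?thesis ..
qed

text \<open>The disc of squared radius \<open>r\<close> has area \<pi> times \<open>r\<close>, which
  is linear in \<open>r\<close>; hence the constant density. Half-lines form an intersection-stable
  generator, so comparing the measures there suffices.\<close>

lemma distr_lborel_cmod_square:
  "distr (lborel :: complex measure) borel (\<lambda>z. (cmod z)\<^sup>2) =
     density lborel (\<lambda>t. ennreal pi * indicator {0..} t)" (is "?M = ?N")
proof (rule measure_eqI_generator_eq)
  have [measurable]: "(\<lambda>z. (cmod z)\<^sup>2) \<in> borel_measurable borel" by measurable
  let ?E = "range (\<lambda>r::real. {..r})"
  show "Int_stable ?E" by (auto simp: Int_stable_def)
  show "?E \<subseteq> Pow UNIV" by auto
  show "sets ?M = sigma_sets UNIV ?E" "sets ?N = sigma_sets UNIV ?E"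
    by (simp_all add: borel_eq_atMost)
  show "range (\<lambda>n. {..real n}) \<subseteq> ?E" "(\<Union>i. {..real i}) = UNIV"
    by (auto simp: real_arch_simple)
  \<comment> \<open>\<open>max 0 r\<close> covers negative \<open>r\<close>, for which the sublevel
    set is empty.\<close>
  have M: "emeasure ?M {..r} = ennreal (pi * max 0 r)" for r
  proof (cases "r \<ge> 0")
    case True
    have "emeasure ?M {..r} = emeasure lborel {z. (cmod z)\<^sup>2 \<le> r}"
      by (subst emeasure_distr) (auto intro!: arg_cong[where f="emeasure lborel"])
    also have "{z. (cmod z)\<^sup>2 \<le> r} = cball 0 (sqrt r)"
      using True by (auto simp: real_le_rsqrt) (metis norm_ge_zero real_sqrt_le_iff real_sqrt_pow2 real_sqrt_abs abs_of_nonneg power_mono)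
    also have "emeasure lborel \<dots> = ennreal (pi * r)"
      using True by (subst emeasure_cball) (auto simp: eval_unit_ball_vol)
    finally show ?thesis using True by simp
  next
    case False
    hence "{z. (cmod z)\<^sup>2 \<le> r} = {}"
      by (smt (verit) Collect_empty_eq zero_le_power2)
    hence "(\<lambda>z. (cmod z)\<^sup>2) -` {..r} = {}" by auto
    thus ?thesis using False by (subst emeasure_distr) auto
  qed
  show "emeasure ?M {..real i} \<noteq> \<infinity>" for i unfolding M by simp
  show "emeasure ?M X = emeasure ?N X" if X: "X \<in> ?E" for X
  proof -
    obtain r where X: "X = {..r}" using X by auto
    have "emeasure ?N X = (\<integral>\<^sup>+t. ennreal pi * indicator {0..r} t \<partial>lborel)"
      unfolding X by (subst emeasure_density) (auto intro!: nn_integral_cong simp: indicator_def)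
    also have "\<dots> = ennreal pi * ennreal (max 0 r)"
      by (subst nn_integral_cmult_indicator) (auto simp: emeasure_lborel_Icc_eq max_def)
    finally show ?thesis unfolding X M by (simp add: ennreal_mult')
  qed
qed

text \<open>Passing to t = |z|^2 leaves \<pi> times a one-dimensional integral over the half-line,
  and the scaling t -> t/\<alpha> reduces that to Euler's integral for
  \<open>fact k\<close>.\<close>

lemma nn_integral_gaussian_moment:
  assumes "\<alpha> > 0"
  shows "(\<integral>\<^sup>+z. ennreal ((cmod z) ^ (2 * k) * exp (- \<alpha> * (cmod z)\<^sup>2)) \<partial>lborel) =
           ennreal (pi * fact k / \<alpha> ^ Suc k)"
proof -
  have [measurable]: "(\<lambda>z. (cmod z)\<^sup>2) \<in> borel_measurable borel" by measurable
  have "(\<integral>\<^sup>+z. ennreal ((cmod z) ^ (2 * k) * exp (- \<alpha> * (cmod z)\<^sup>2)) \<partial>lborel) =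
        (\<integral>\<^sup>+t. ennreal (t ^ k * exp (- \<alpha> * t)) \<partial>distr (lborel :: complex measure) borel (\<lambda>z. (cmod z)\<^sup>2))"
    by (subst nn_integral_distr) (auto simp: power_mult)
  also have "\<dots> = (\<integral>\<^sup>+t. ennreal pi * (ennreal (t ^ k * exp (- \<alpha> * t)) * indicator {0..} t) \<partial>lborel)"
    unfolding distr_lborel_cmod_square by (subst nn_integral_density) (auto simp: mult_ac)
  also have "\<dots> = ennreal pi * (\<integral>\<^sup>+t. ennreal (t ^ k * exp (- \<alpha> * t)) * indicator {0..} t \<partial>lborel)"
    by (subst nn_integral_cmult) auto
  also have "(\<integral>\<^sup>+t. ennreal (t ^ k * exp (- \<alpha> * t)) * indicator {0..} t \<partial>lborel) =
      ennreal (1 / \<alpha>) * (\<integral>\<^sup>+t. ennreal ((t / \<alpha>) ^ k * exp (- t)) * indicator {0..} t \<partial>lborel)"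
    using assms by (subst nn_integral_real_affine[where c = "1 / \<alpha>" and t = 0])
      (auto intro!: nn_integral_cong simp: indicator_def zero_le_divide_iff)
  also have "(\<integral>\<^sup>+t. ennreal ((t / \<alpha>) ^ k * exp (- t)) * indicator {0..} t \<partial>lborel) =
      (\<integral>\<^sup>+t. ennreal (1 / \<alpha> ^ k) * (ennreal (t ^ k * exp (- t)) * indicator {0..} t) \<partial>lborel)"
    using assms by (intro nn_integral_cong)
       (auto simp: indicator_def power_divide simp flip: ennreal_mult')
  also have "\<dots> = ennreal (1 / \<alpha> ^ k) * ennreal (fact k)"
    by (subst nn_integral_cmult) (auto simp: nn_intergal_power_times_exp_Ici)
  also have "ennreal pi * (ennreal (1 / \<alpha>) * \<dots>) = ennreal (pi * fact k / \<alpha> ^ Suc k)"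
    using assms by (simp flip: ennreal_mult' add: field_simps)
  finally show ?thesis .
qed

subsection \<open>Parseval's identity with Gaussian weight\<close>

text \<open>For distinct \<open>k\<close>, \<open>l\<close> this is a geometric sum whose ratio
  \<open>q\<close> is an \<open>N\<close>-th root of unity other than 1.\<close>

lemma sum_cis_orthogonal:
  fixes N k l :: nat
  assumes "k < N" "l < N"
  shows "(\<Sum>j<N. cis (2 * pi * real j / N) ^ k * cnj (cis (2 * pi * real j / N) ^ l)) = (if k = l then of_nat N else 0)"
proof (cases "k = l")
  case True
  thus ?thesis by (simp add: cis_mult Complex.DeMoivre cis_cnj)
next
  case False
  define q where "q = cis (2 * pi * (real k - real l) / N)"
  have N: "N > 0" using assms by auto
  \<comment> \<open>If \<open>q = 1\<close>, then \<open>N\<close> divides \<open>k - l\<close>;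
    since |k - l| < N this forces \<open>k = l\<close>.\<close>
  have q1: "q \<noteq> 1"
  proof
    assume "q = 1"
    hence "cos (2 * pi * (real k - real l) / N) = 1"
      by (simp add: q_def complex_eq_iff)
    then obtain x :: int where "2 * pi * (real k - real l) / N = real_of_int x * 2 * pi"
      by (auto simp: cos_one_2pi_int)
    hence "(2 * pi) * (real k - real l) = (2 * pi) * (real_of_int x * real N)"
      using N by (simp add: field_simps)
    hence "real k - real l = real_of_int x * real N"
      by (subst (asm) mult_left_cancel) auto
    hence "int k - int l = x * int N"
      by (metis of_int_diff of_int_eq_iff of_int_mult of_int_of_nat_eq)
    moreover from this have "x = 0"
    proof -
      have "\<bar>int k - int l\<bar> < int N" using assms by auto
      with \<open>int k - int l = x * int N\<close> have "\<bar>x\<bar> * int N < 1 * int N" by (simp add: abs_mult)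
      thus ?thesis using N mult_less_cancel_right_pos[of "int N" "\<bar>x\<bar>" 1] by simp
    qed
    ultimately show False using False by simp
  qed
  have "q ^ N = cis (2 * pi * (real k - real l))"
    using N by (simp add: q_def Complex.DeMoivre)
  also have "\<dots> = cis (2 * pi * of_int (int k - int l))" by simp
  also have "\<dots> = 1" by (rule cis_multiple_2pi) auto
  finally have qN: "q ^ N = 1" .
  have "(\<Sum>j<N. cis (2 * pi * real j / N) ^ k * cnj (cis (2 * pi * real j / N) ^ l)) = (\<Sum>j<N. q ^ j)"
    by (intro sum.cong refl)
       (simp add: q_def Complex.DeMoivre cis_cnj cis_mult algebra_simps diff_divide_distrib)
  also have "\<dots> = 0"
    using q1 qN by (simp add: geometric_sum)
  finally show ?thesis using False by simp
qed

text \<open>Discrete Parseval: expanding the squares gives a double sum over \<open>k\<close>,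
  \<open>l\<close> whose off-diagonal part vanishes by orthogonality. It is exact because all
  exponents are below the number \<open>N\<close> of sample points.\<close>

lemma sum_norm_square_roots_of_unity:
  fixes a :: "nat \<Rightarrow> complex" and N :: nat
  shows "(\<Sum>j<N. (cmod (\<Sum>k<N. a k * (cis (2 * pi * real j / N) * z) ^ k))\<^sup>2) =
           N * (\<Sum>k<N. (cmod (a k))\<^sup>2 * cmod z ^ (2 * k))"
proof -
  have "complex_of_real (\<Sum>j<N. (cmod (\<Sum>k<N. a k * (cis (2 * pi * real j / N) * z) ^ k))\<^sup>2) =
    (\<Sum>j<N. \<Sum>k<N. \<Sum>l<N. a k * (cis (2 * pi * real j / N) * z) ^ k * cnj (a l * (cis (2 * pi * real j / N) * z) ^ l))"
    unfolding of_real_sum complex_norm_square cnj_sum sum_product ..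
  also have "\<dots> = (\<Sum>k<N. \<Sum>l<N. \<Sum>j<N. a k * (cis (2 * pi * real j / N) * z) ^ k * cnj (a l * (cis (2 * pi * real j / N) * z) ^ l))"
    by (rule trans[OF sum.swap], rule sum.cong[OF refl], rule sum.swap)
  also have "\<dots> = (\<Sum>k<N. \<Sum>l<N. (a k * z ^ k * cnj (a l * z ^ l)) *
      (\<Sum>j<N. cis (2 * pi * real j / N) ^ k * cnj (cis (2 * pi * real j / N) ^ l)))"
    by (simp add: sum_distrib_left power_mult_distrib mult_ac)
  also have "\<dots> = (\<Sum>k<N. \<Sum>l<N. if k = l then (a k * z ^ k * cnj (a l * z ^ l)) * of_nat N else 0)"
    by (intro sum.cong refl, subst sum_cis_orthogonal) auto
  also have "\<dots> = (\<Sum>k<N. (a k * z ^ k * cnj (a k * z ^ k)) * of_nat N)"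
    by (intro sum.cong refl) (simp add: sum.delta)
  also have "\<dots> = complex_of_real (N * (\<Sum>k<N. (cmod (a k))\<^sup>2 * cmod z ^ (2 * k)))"
    unfolding of_real_mult of_real_sum sum_distrib_left
    by (intro sum.cong refl) 
       (simp add: complex_norm_square[symmetric] norm_mult norm_power power_mult_distrib power_mult [symmetric] mult_ac del: complex_cnj_mult complex_cnj_power)
  finally show ?thesis unfolding of_real_eq_iff .
qed

text \<open>For the Taylor polynomial with \<open>N\<close> terms the average over
  \<open>N\<close>-th roots of unity is exactly a partial sum of the limit. Replacing
  \<open>f\<close> by that polynomial costs at most a constant times a tail of the absolutely
  convergent series on the circle. Indexing by \<open>Suc N\<close> makes every average a genuine
  mean.\<close>

lemma circle_average_tendsto:
  fixes a :: "nat \<Rightarrow> complex"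
  assumes f: "\<And>z. (\<lambda>k. a k * z ^ k) sums f z"
  shows "summable (\<lambda>k. (cmod (a k))\<^sup>2 * cmod z ^ (2 * k))"
    and "(\<lambda>N. (\<Sum>j<Suc N. (cmod (f (cis (2 * pi * real j / Suc N) * z)))\<^sup>2) / Suc N)
           \<longlonglongrightarrow> (\<Sum>k. (cmod (a k))\<^sup>2 * cmod z ^ (2 * k))"
proof -
  define b where "b = (\<lambda>k. cmod (a k) * cmod z ^ k)"
  have b0: "b k \<ge> 0" for k by (simp add: b_def)
  \<comment> \<open>Convergence at the larger radius \<open>cmod z + 1\<close> gives absolute
    convergence at radius \<open>cmod z\<close>.\<close>
  have sb: "summable b"
  proof -
    have "summable (\<lambda>k. a k * (of_real (cmod z + 1)) ^ k)"
      using f sums_summable by blast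
    hence "summable (\<lambda>k. cmod (a k * (of_real (cmod z)) ^ k))"
      by (rule powser_insidea) simp
    thus ?thesis by (simp add: b_def norm_mult norm_power)
  qed
  define B where "B = suminf b"
  have B0: "B \<ge> 0" unfolding B_def using sb b0 by (rule suminf_nonneg)
  have bB: "sum b {..<N} \<le> B" for N
    unfolding B_def using sb b0 by (intro sum_le_suminf) auto
  have bkB: "b k \<le> B" for k
    using bB[of "Suc k"] sum_nonneg[of "{..<k}" b] b0 by simp
  have eq: "(cmod (a k))\<^sup>2 * cmod z ^ (2 * k) = (b k)\<^sup>2" for k
    by (simp add: b_def power_mult_distrib power_mult [symmetric] mult_ac)
  show summ: "summable (\<lambda>k. (cmod (a k))\<^sup>2 * cmod z ^ (2 * k))"
    unfolding eq
  proof (rule summable_comparison_test')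
    show "summable (\<lambda>k. B * b k)" using sb by (rule summable_mult)
    show "norm ((b k)\<^sup>2) \<le> B * b k" if "k \<ge> 0" for k
      using bkB[of k] b0[of k] by (simp add: power2_eq_square mult_right_mono)
  qed
  define p where "p = (\<lambda>N w. \<Sum>k<N. a k * w ^ k)"
  \<comment> \<open>Factor the difference of squares: on the whole circle both moduli are at most
    \<open>B\<close>, and |f - p| is at most the tail of \<open>b\<close>. The bound does not depend
    on the point, so it survives averaging.\<close>
  have circ: "\<bar>(cmod (f w))\<^sup>2 - (cmod (p N w))\<^sup>2\<bar> \<le> (B - sum b {..<N}) * (2 * B)"
    if "cmod w = cmod z" for w N
  proof -
    have nb: "cmod (a k * w ^ k) = b k" for k
      by (simp add: b_def norm_mult norm_power that)
    have fw: "f w = (\<Sum>k. a k * w ^ k)" using f by (rule sums_unique)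
    have f: "cmod (f w) \<le> B"
      unfolding fw B_def nb[symmetric] using sb by (intro summable_norm) (simp add: nb)
    have p: "cmod (p N w) \<le> B"
      using sum_norm_le[of "{..<N}" "\<lambda>k. a k * w ^ k" b] nb bB[of N] by (simp add: p_def)
    have "f w - p N w = (\<Sum>k. a (k + N) * w ^ (k + N))"
      unfolding fw p_def using suminf_minus_initial_segment[OF sums_summable[OF assms]] by simp
    also have "cmod \<dots> \<le> (\<Sum>k. cmod (a (k + N) * w ^ (k + N)))"
      using sb by (intro summable_norm) (simp only: nb summable_iff_shift)
    also have "\<dots> = B - sum b {..<N}"
      unfolding nb B_def using suminf_minus_initial_segment[OF sb] by simp
    finally have d: "cmod (f w - p N w) \<le> B - sum b {..<N}" .
    have "\<bar>(cmod (f w))\<^sup>2 - (cmod (p N w))\<^sup>2\<bar> = \<bar>cmod (f w) - cmod (p N w)\<bar> * (cmod (f w) + cmod (p N w))"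
      by (simp add: power2_eq_square square_diff_square_factored abs_mult mult_ac)
    also have "\<dots> \<le> (B - sum b {..<N}) * (2 * B)"
      using d f p norm_triangle_ineq3[of "f w" "p N w"] by (intro mult_mono) auto
    finally show ?thesis .
  qed
  define A where "A = (\<lambda>N::nat. (\<Sum>j<N. (cmod (f (cis (2 * pi * real j / N) * z)))\<^sup>2) / N)"
  define Q where "Q = (\<lambda>N. \<Sum>k<N. (cmod (a k))\<^sup>2 * cmod z ^ (2 * k))"
  have AQ: "\<bar>A N - Q N\<bar> \<le> (B - sum b {..<N}) * (2 * B)" if N: "N > 0" for N :: nat
  proof -
    have "real N * Q N = (\<Sum>j<N. (cmod (p N (cis (2 * pi * real j / N) * z)))\<^sup>2)"
      unfolding Q_def p_def sum_norm_square_roots_of_unity ..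
    moreover have "real N * A N = (\<Sum>j<N. (cmod (f (cis (2 * pi * real j / N) * z)))\<^sup>2)"
      using N by (simp add: A_def)
    moreover have "real N * \<bar>A N - Q N\<bar> = \<bar>real N * A N - real N * Q N\<bar>"
      by (simp add: abs_mult flip: right_diff_distrib)
    ultimately have "real N * \<bar>A N - Q N\<bar> =
      \<bar>\<Sum>j<N. (cmod (f (cis (2 * pi * real j / N) * z)))\<^sup>2 - (cmod (p N (cis (2 * pi * real j / N) * z)))\<^sup>2\<bar>"
      by (simp only: sum_subtractf)
    also have "\<dots> \<le> (\<Sum>j<N. (B - sum b {..<N}) * (2 * B))"
      by (intro order.trans[OF sum_abs] sum_mono circ) (simp add: norm_mult)
    also have "\<dots> = real N * ((B - sum b {..<N}) * (2 * B))" by simp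
    finally show ?thesis using N by (subst (asm) mult_le_cancel_left_pos) auto
  qed
  have "(\<lambda>N. (B - sum b {..<N}) * (2 * B)) \<longlonglongrightarrow> (B - B) * (2 * B)"
    unfolding B_def by (intro tendsto_intros summable_LIMSEQ sb)
  hence null: "(\<lambda>N. (B - sum b {..<N}) * (2 * B)) \<longlonglongrightarrow> 0"
    by (simp only: diff_self mult_zero_left)
  have "\<forall>\<^sub>F N in sequentially. norm (A N - Q N) \<le> (B - sum b {..<N}) * (2 * B)"
    unfolding real_norm_def using eventually_gt_at_top[of 0] by eventually_elim (rule AQ)
  from this null have "(\<lambda>N. A N - Q N) \<longlonglongrightarrow> 0"
    by (rule Lim_null_comparison)
  moreover have "Q \<longlonglongrightarrow> (\<Sum>k. (cmod (a k))\<^sup>2 * cmod z ^ (2 * k))"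
    unfolding Q_def by (intro summable_LIMSEQ summ)
  ultimately have "(\<lambda>N. (A N - Q N) + Q N) \<longlonglongrightarrow> 0 + (\<Sum>k. (cmod (a k))\<^sup>2 * cmod z ^ (2 * k))"
    by (rule tendsto_add)
  hence "A \<longlonglongrightarrow> (\<Sum>k. (cmod (a k))\<^sup>2 * cmod z ^ (2 * k))" by simp
  from LIMSEQ_Suc[OF this] show "(\<lambda>N. (\<Sum>j<Suc N. (cmod (f (cis (2 * pi * real j / Suc N) * z)))\<^sup>2) / Suc N)
           \<longlonglongrightarrow> (\<Sum>k. (cmod (a k))\<^sup>2 * cmod z ^ (2 * k))"
    by (simp only: A_def)
qed

section \<open>Averages over rotations under the integral, and the norm identity\<close>

lemma nn_integral_average_rotations:
  fixes F :: "complex \<Rightarrow> ennreal" and N :: nat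
  assumes [measurable]: "F \<in> borel_measurable borel" and N: "N > 0"
  shows "(\<integral>\<^sup>+z. (\<Sum>j<N. F (cis (2 * pi * real j / N) * z)) / N \<partial>lborel) = (\<integral>\<^sup>+z. F z \<partial>lborel)"
proof -
  have "(\<integral>\<^sup>+z. (\<Sum>j<N. F (cis (2 * pi * real j / N) * z)) / N \<partial>lborel) =
      (\<Sum>j<N. \<integral>\<^sup>+z. F (cis (2 * pi * real j / N) * z) \<partial>lborel) / N"
    by (subst nn_integral_divide) (auto simp: nn_integral_sum)
  also have "\<dots> = (\<Sum>j<N. \<integral>\<^sup>+z. F z \<partial>lborel) / N"
    by (simp add: nn_integral_lborel_rotation)
  also have "\<dots> = (\<integral>\<^sup>+z. F z \<partial>lborel)"
    using N ennreal_mult_divide_eq[of "of_nat N" "integral\<^sup>N lborel F"]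
    by (simp add: mult.commute flip: ennreal_of_nat_eq_real_of_nat)
  finally show ?thesis .
qed

text \<open>The Gaussian weight depends only on |z|, so it factors out of the rotation average and
  only |f|^2 is averaged.\<close>

lemma nn_integral_fock_average:
  fixes N :: nat
  assumes [measurable]: "f \<in> borel_measurable borel" and N: "N > 0"
  shows "(\<integral>\<^sup>+z. ennreal (fock_integrand \<alpha> f z) \<partial>lborel) =
     (\<integral>\<^sup>+z. ennreal ((\<Sum>j<N. (cmod (f (cis (2 * pi * real j / N) * z)))\<^sup>2) / N * exp (- \<alpha> * (cmod z)\<^sup>2)) \<partial>lborel)"
proof -
  have [measurable]: "fock_integrand \<alpha> f \<in> borel_measurable borel"
    unfolding fock_integrand_def by measurable
  have "(\<Sum>j<N. ennreal (fock_integrand \<alpha> f (cis (2 * pi * real j / N) * z))) / N =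
     ennreal ((\<Sum>j<N. (cmod (f (cis (2 * pi * real j / N) * z)))\<^sup>2) / N * exp (- \<alpha> * (cmod z)\<^sup>2))" for z
    using N by (simp add: fock_integrand_def norm_mult sum_ennreal sum_distrib_right divide_ennreal
        ennreal_of_nat_eq_real_of_nat sum_nonneg)
  thus ?thesis
    using nn_integral_average_rotations[of "\<lambda>z. ennreal (fock_integrand \<alpha> f z)" N] N by simp
qed

text \<open>Each inequality is an application of Fatou's lemma, to different approximations of the
  integrand. Both sides live in \<open>ennreal\<close>, so the infinite case is included and
  membership in the Fock space can later be read off from the series.\<close>

lemma nn_integral_fock_parseval:
  fixes a :: "nat \<Rightarrow> complex"
  assumes \<alpha>: "\<alpha> > 0" and f: "\<And>z. (\<lambda>k. a k * z ^ k) sums f z"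
    and [measurable]: "f \<in> borel_measurable borel"
  shows "(\<integral>\<^sup>+z. ennreal (fock_integrand \<alpha> f z) \<partial>lborel) =
           (\<Sum>k. ennreal (pi / \<alpha> * ((cmod (a k))\<^sup>2 * fact k / \<alpha> ^ k)))" (is "?I = ?S")
proof (rule antisym)
  let ?W = "\<lambda>z. exp (- \<alpha> * (cmod z)\<^sup>2)"
  let ?t = "\<lambda>k z. ennreal ((cmod (a k))\<^sup>2 * cmod z ^ (2 * k) * ?W z)"
  have trm: "(\<integral>\<^sup>+z. ?t k z \<partial>lborel) = ennreal (pi / \<alpha> * ((cmod (a k))\<^sup>2 * fact k / \<alpha> ^ k))" for k
  proof -
    have "(\<integral>\<^sup>+z. ?t k z \<partial>lborel) = (\<integral>\<^sup>+z. ennreal ((cmod (a k))\<^sup>2) * ennreal (cmod z ^ (2 * k) * ?W z) \<partial>lborel)"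
      by (intro nn_integral_cong) (simp add: ennreal_mult' mult.assoc)
    also have "\<dots> = ennreal ((cmod (a k))\<^sup>2) * ennreal (pi * fact k / \<alpha> ^ Suc k)"
      using nn_integral_gaussian_moment[OF \<alpha>, of k] by (subst nn_integral_cmult) auto
    also have "\<dots> = ennreal (pi / \<alpha> * ((cmod (a k))\<^sup>2 * fact k / \<alpha> ^ k))"
      using \<alpha> by (simp flip: ennreal_mult' add: field_simps)
    finally show ?thesis .
  qed
  have sum_eq: "(\<integral>\<^sup>+z. (\<Sum>k. ?t k z) \<partial>lborel) = ?S"
    unfolding trm[symmetric] by (rule nn_integral_suminf) measurable

  \<comment> \<open>Here Fatou is applied to the averages \<open>A N\<close>: they converge
    pointwise to the diagonal series, while all their integrals equal that of
    \<open>f\<close>.\<close>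
  show "?S \<le> ?I"
  proof -
    define A where "A = (\<lambda>N z. (\<Sum>j<Suc N. (cmod (f (cis (2 * pi * real j / Suc N) * z)))\<^sup>2) / Suc N * ?W z)"
    have lim: "(\<lambda>N. ennreal (A N z)) \<longlonglongrightarrow> (\<Sum>k. ?t k z)" for z
    proof -
      have "(\<Sum>k. ?t k z) = ennreal (\<Sum>k. (cmod (a k))\<^sup>2 * cmod z ^ (2 * k) * ?W z)"
        using circle_average_tendsto(1)[OF f]
        by (intro suminf_ennreal2 summable_mult2) auto
      also have "\<dots> = ennreal ((\<Sum>k. (cmod (a k))\<^sup>2 * cmod z ^ (2 * k)) * ?W z)"
        using suminf_mult2[OF circle_average_tendsto(1)[OF f]] by simp
      finally show ?thesis
        unfolding A_def
        by (simp only:) (intro tendsto_ennrealI tendsto_mult tendsto_const circle_average_tendsto(2)[OF f])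
    qed
    have [measurable]: "A N \<in> borel_measurable borel" for N unfolding A_def by measurable
    have "?S = (\<integral>\<^sup>+z. liminf (\<lambda>N. ennreal (A N z)) \<partial>lborel)"
      unfolding sum_eq[symmetric]
      by (intro nn_integral_cong lim_imp_Liminf[symmetric] lim) auto
    also have "\<dots> \<le> liminf (\<lambda>N. \<integral>\<^sup>+z. ennreal (A N z) \<partial>lborel)"
      by (intro nn_integral_liminf) auto
    also have "(\<lambda>N. \<integral>\<^sup>+z. ennreal (A N z) \<partial>lborel) = (\<lambda>N. ?I)"
      using nn_integral_fock_average[of f "Suc N" \<alpha> for N] by (simp add: A_def del: sum.lessThan_Suc of_nat_Suc)
    finally show ?thesis by (simp add: Liminf_const)
  qed

  \<comment> \<open>Here Fatou is applied to the Taylor polynomials, which converge pointwise to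
    \<open>f\<close> and whose integrals are partial sums of \<open>?S\<close>.\<close>
  show "?I \<le> ?S"
  proof -
    define p where "p = (\<lambda>N z. \<Sum>k<N. a k * z ^ k)"
    have [measurable]: "p N \<in> borel_measurable borel" for N unfolding p_def by measurable
    have lim: "(\<lambda>N. ennreal (fock_integrand \<alpha> (p (Suc N)) z)) \<longlonglongrightarrow> ennreal (fock_integrand \<alpha> f z)" for z
      using LIMSEQ_Suc[OF f[unfolded sums_def, of z]]
      unfolding fock_integrand_def p_def by (intro tendsto_intros)
    have "?I = (\<integral>\<^sup>+z. liminf (\<lambda>N. ennreal (fock_integrand \<alpha> (p (Suc N)) z)) \<partial>lborel)"
      by (intro nn_integral_cong lim_imp_Liminf[symmetric] lim) auto
    also have "\<dots> \<le> liminf (\<lambda>N. \<integral>\<^sup>+z. ennreal (fock_integrand \<alpha> (p (Suc N)) z) \<partial>lborel)"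
      unfolding fock_integrand_def by (intro nn_integral_liminf) measurable
    also have "\<dots> \<le> liminf (\<lambda>N::nat. ?S)"
    proof (intro Liminf_mono always_eventually allI)
      fix N
      have "(\<integral>\<^sup>+z. ennreal (fock_integrand \<alpha> (p (Suc N)) z) \<partial>lborel) =
            (\<integral>\<^sup>+z. (\<Sum>k<Suc N. ?t k z) \<partial>lborel)"
        \<comment> \<open>The polynomial has \<open>Suc N\<close> coefficients, so averaging over
          \<open>Suc N\<close> roots of unity leaves precisely its diagonal terms.\<close>
        by (subst nn_integral_fock_average[of _ "Suc N"]; (simp only: p_def sum_norm_square_roots_of_unity)?)
           (auto intro!: nn_integral_cong simp: sum_ennreal sum_distrib_right simp del: sum.lessThan_Suc)
      also have "\<dots> \<le> (\<integral>\<^sup>+z. (\<Sum>k. ?t k z) \<partial>lborel)"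
        by (intro nn_integral_mono sum_le_suminf) auto
      finally show "(\<integral>\<^sup>+z. ennreal (fock_integrand \<alpha> (p (Suc N)) z) \<partial>lborel) \<le> ?S"
        by (simp only: sum_eq)
    qed
    finally show ?thesis by (simp add: Liminf_const)
  qed
qed

subsection \<open>The Fock norm in terms of Taylor coefficients\<close>

definition taylor_coeff :: "(complex \<Rightarrow> complex) \<Rightarrow> nat \<Rightarrow> complex" where
  "taylor_coeff f k = (deriv ^^ k) f 0 / fact k"

lemma taylor_coeff_sums:
  assumes "f holomorphic_on UNIV"
  shows "(\<lambda>k. taylor_coeff f k * z ^ k) sums f z"
  using holomorphic_power_series[of f 0 "cmod z + 1" z] holomorphic_on_subset[OF assms]
  by (simp add: taylor_coeff_def)

text \<open>Convergence everywhere makes \<open>Abs_fps a\<close> a formal power series of infinite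
  radius that evaluates to \<open>f\<close>, and the expansion of a function at 0 is unique.\<close>

lemma taylor_coeff_unique:
  assumes "\<And>z. (\<lambda>k. a k * z ^ k) sums f z"
  shows "taylor_coeff f k = a k"
proof -
  have "fps_conv_radius (Abs_fps a) = \<infinity>"
    unfolding fps_conv_radius_def using assms sums_summable by (intro conv_radius_inftyI'') auto
  moreover have "eval_fps (Abs_fps a) = f"
    using assms by (auto simp: eval_fps_def fun_eq_iff sums_iff)
  ultimately have "f has_fps_expansion Abs_fps a"
    by (simp add: has_fps_expansion_def)
  from fps_nth_fps_expansion[OF this] show ?thesis
    by (simp add: taylor_coeff_def)
qed

lemma entire_of_sums:
  assumes "\<And>z. (\<lambda>k. a k * z ^ k) sums f z"
  shows "f holomorphic_on UNIV"
proof (subst holomorphic_on_open, simp, intro ballI)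
  fix z :: complex
  have "f holomorphic_on ball 0 (cmod z + 1)"
    using assms by (intro power_series_holomorphic[of _ _ a]) simp
  thus "\<exists>f'. (f has_field_derivative f') (at z)"
    by (subst (asm) holomorphic_on_open) auto
qed

text \<open>The share of the \<open>k\<close>-th Taylor coefficient in the squared norm: the
  monomials are orthogonal, and that of degree \<open>k\<close> has squared norm
  k!/\<alpha>^k.\<close>

definition fock_term :: "real \<Rightarrow> (complex \<Rightarrow> complex) \<Rightarrow> nat \<Rightarrow> real" where
  "fock_term \<alpha> f k = (cmod (taylor_coeff f k))\<^sup>2 * fact k / \<alpha> ^ k"

context
  fixes \<alpha> :: real
  assumes \<alpha>: "\<alpha> > 0"
begin

lemma fock_term_nonneg: "fock_term \<alpha> f k \<ge> 0"
  using \<alpha> by (simp add: fock_term_def)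

lemma nn_integral_fock_integrand:
  assumes "f holomorphic_on UNIV"
  shows "(\<integral>\<^sup>+z. ennreal (fock_integrand \<alpha> f z) \<partial>lborel) = (\<Sum>k. ennreal (pi / \<alpha> * fock_term \<alpha> f k))"
  unfolding fock_term_def
  using nn_integral_fock_parseval[OF \<alpha> taylor_coeff_sums[OF assms]] assms
  by (simp add: borel_measurable_continuous_onI holomorphic_on_imp_continuous_on)

lemma fock_integrand_measurable:
  assumes "f holomorphic_on UNIV"
  shows "fock_integrand \<alpha> f \<in> borel_measurable lborel"
proof -
  have [measurable]: "f \<in> borel_measurable borel"
    using assms by (simp add: borel_measurable_continuous_onI holomorphic_on_imp_continuous_on)
  show ?thesis unfolding fock_integrand_def by measurable
qed

lemma fock_integrand_nonneg: "fock_integrand \<alpha> f z \<ge> 0"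
  by (simp add: fock_integrand_def)

text \<open>For a nonnegative measurable integrand, integrability is finiteness of the nonnegative
  integral, which the Parseval identity turns into convergence of a series of nonnegative
  reals.\<close>

lemma fock_space_iff:
  "f \<in> fock_space \<alpha> \<longleftrightarrow> f holomorphic_on UNIV \<and> summable (fock_term \<alpha> f)"
proof (cases "f holomorphic_on UNIV")
  case hol: True
  have "integrable lborel (fock_integrand \<alpha> f) \<longleftrightarrow> (\<Sum>k. ennreal (pi / \<alpha> * fock_term \<alpha> f k)) < \<infinity>"
    using fock_integrand_measurable[OF hol]
    by (simp add: integrable_iff_bounded fock_integrand_nonneg nn_integral_fock_integrand[OF hol])
  also have "\<dots> \<longleftrightarrow> summable (\<lambda>k. pi / \<alpha> * fock_term \<alpha> f k)"
  proof
    assume "(\<Sum>k. ennreal (pi / \<alpha> * fock_term \<alpha> f k)) < \<infinity>"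
    thus "summable (\<lambda>k. pi / \<alpha> * fock_term \<alpha> f k)"
      using \<alpha> by (intro summable_suminf_not_top) (auto simp: fock_term_nonneg)
  next
    assume "summable (\<lambda>k. pi / \<alpha> * fock_term \<alpha> f k)"
    thus "(\<Sum>k. ennreal (pi / \<alpha> * fock_term \<alpha> f k)) < \<infinity>"
      using \<alpha> by (subst suminf_ennreal2) (auto simp: fock_term_nonneg)
  qed
  also have "\<dots> \<longleftrightarrow> summable (fock_term \<alpha> f)"
    using \<alpha> by (intro summable_cmult_iff[THEN trans]) auto
  finally show ?thesis using hol by (simp add: fock_space_def)
qed (simp add: fock_space_def)

text \<open>The normalisation \<alpha>/\<pi> cancels the factor from the Parseval identity.
  Membership ensures that neither the integral nor the series takes a default value.\<close>

lemma fock_norm_eq: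
  assumes "f \<in> fock_space \<alpha>"
  shows "fock_norm \<alpha> f = sqrt (\<Sum>k. fock_term \<alpha> f k)"
proof -
  have hol: "f holomorphic_on UNIV" and summ: "summable (fock_term \<alpha> f)"
    using assms by (auto simp: fock_space_iff)
  have "(LINT z|lborel. fock_integrand \<alpha> f z) = enn2real (\<Sum>k. ennreal (pi / \<alpha> * fock_term \<alpha> f k))"
    using fock_integrand_measurable[OF hol]
    by (subst integral_eq_nn_integral)
       (auto simp: fock_integrand_nonneg nn_integral_fock_integrand[OF hol])
  also have "\<dots> = pi / \<alpha> * (\<Sum>k. fock_term \<alpha> f k)"
    using \<alpha> summ suminf_nonneg[OF summ fock_term_nonneg]
    by (subst suminf_ennreal2) (auto simp: fock_term_nonneg suminf_mult[OF summ] simp del: times_divide_eq_left)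
  finally show ?thesis using \<alpha> by (simp add: fock_norm_def)
qed

end

section \<open>Subtracting polynomials and Taylor remainders\<close>

lemma poly_sums:
  fixes p :: "'a :: real_normed_field poly"
  shows "(\<lambda>k. coeff p k * z ^ k) sums poly p z"
  using sums_finite[of "{..degree p}" "\<lambda>k. coeff p k * z ^ k"]
  by (simp add: poly_altdef coeff_eq_0)

lemma taylor_coeff_diff_poly:
  assumes "f holomorphic_on UNIV"
  shows "taylor_coeff (\<lambda>w. f w - poly p w) k = taylor_coeff f k - coeff p k"
  using sums_diff[OF taylor_coeff_sums[OF assms] poly_sums[of p]]
  by (intro taylor_coeff_unique) (simp add: algebra_simps)

lemma taylor0_eq_poly:
  "taylor0 n f = poly (\<Sum>k<n. monom (taylor_coeff f k) k)"
  by (simp add: taylor0_def taylor_coeff_def fun_eq_iff poly_sum poly_monom)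

lemma taylor_coeff_remainder:
  assumes "f holomorphic_on UNIV"
  shows "taylor_coeff (\<lambda>w. f w - taylor0 n f w) k = (if k < n then 0 else taylor_coeff f k)"
proof -
  have "coeff (\<Sum>k<n. monom (taylor_coeff f k) k) k = (if k < n then taylor_coeff f k else 0)"
    by (simp add: coeff_sum)
  thus ?thesis
    using taylor_coeff_diff_poly[OF assms, of "\<Sum>k<n. monom (taylor_coeff f k) k" k]
    by (simp add: taylor0_eq_poly)
qed

text \<open>Subtracting a polynomial changes only finitely many Taylor coefficients, which does not
  affect summability.\<close>

lemma diff_poly_in_fock_space:
  assumes \<alpha>: "\<alpha> > 0" and f: "f \<in> fock_space \<alpha>"
  shows "(\<lambda>w. f w - poly p w) \<in> fock_space \<alpha>"
proof -
  have hol: "f holomorphic_on UNIV" and summ: "summable (fock_term \<alpha> f)"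
    using f \<alpha> by (auto simp: fock_space_iff)
  have "eventually (\<lambda>k. fock_term \<alpha> (\<lambda>w. f w - poly p w) k = fock_term \<alpha> f k) sequentially"
    using eventually_gt_at_top[of "degree p"]
    by eventually_elim (simp add: fock_term_def taylor_coeff_diff_poly[OF hol] coeff_eq_0)
  from summable_cong[OF this] show ?thesis
    using summ hol by (auto simp: fock_space_iff[OF \<alpha>] intro!: holomorphic_intros)
qed

text \<open>The comparison is termwise: the terms of index at least \<open>n\<close> agree on both
  sides, and those below \<open>n\<close> vanish for the Taylor remainder. The condition on
  coefficients says degree less than \<open>n\<close> while admitting the zero polynomial for every
  \<open>n\<close>.\<close>

lemma fock_norm_remainder_le:
  assumes \<alpha>: "\<alpha> > 0" and f: "f \<in> fock_space \<alpha>" and p: "\<And>k. k \<ge> n \<Longrightarrow> coeff p k = 0"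
  shows "fock_norm \<alpha> (\<lambda>w. f w - taylor0 n f w) \<le> fock_norm \<alpha> (\<lambda>w. f w - poly p w)"
proof -
  have hol: "f holomorphic_on UNIV"
    using f \<alpha> by (auto simp: fock_space_iff)
  have p': "(\<lambda>w. f w - poly p w) \<in> fock_space \<alpha>" and t': "(\<lambda>w. f w - taylor0 n f w) \<in> fock_space \<alpha>"
    unfolding taylor0_eq_poly by (rule diff_poly_in_fock_space[OF \<alpha> f])+
  have "fock_term \<alpha> (\<lambda>w. f w - taylor0 n f w) k \<le> fock_term \<alpha> (\<lambda>w. f w - poly p w) k" for k
    using \<alpha> p[of k] by (auto simp: fock_term_def taylor_coeff_remainder[OF hol] taylor_coeff_diff_poly[OF hol])
  thus ?thesis
    unfolding fock_norm_eq[OF \<alpha> p'] fock_norm_eq[OF \<alpha> t']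
    using p' t' by (intro real_sqrt_le_mono suminf_le) (auto simp: fock_space_iff[OF \<alpha>])
qed

lemma higher_deriv_sums:
  assumes "f holomorphic_on UNIV"
  shows "(\<lambda>m. taylor_coeff f (m + n) * (fact (m + n) / fact m) * z ^ m) sums (deriv ^^ n) f z"
proof -
  have "taylor_coeff ((deriv ^^ n) f) m = taylor_coeff f (m + n) * (fact (m + n) / fact m)" for m
    by (simp add: taylor_coeff_def funpow_add)
  with taylor_coeff_sums[OF holomorphic_higher_deriv[OF assms], of n z] show ?thesis by simp
qed

subsection \<open>The extremal function and the sharp constant\<close>

text \<open>The \<open>m\<close>-th term of the Kummer series for the square of the sharp constant,
  with the Pochhammer symbols written as factorials.\<close>

definition fock_const_term :: "real \<Rightarrow> nat \<Rightarrow> real \<Rightarrow> nat \<Rightarrow> real" where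
  "fock_const_term \<alpha> n x m = \<alpha> ^ n * fact (m + n) / (fact m)\<^sup>2 * x ^ m"

lemma fock_extremal_sums:
  "(\<lambda>k. (if k < n then 0 else of_real (\<alpha> ^ n) * (of_real \<alpha> * cnj z) ^ (k - n) / fact (k - n)) * w ^ k)
     sums fock_extremal \<alpha> n z w" (is "?g sums _")
proof -
  have "(\<lambda>m. of_real (\<alpha> ^ n) * w ^ n * ((of_real \<alpha> * cnj z * w) ^ m /\<^sub>R fact m)) sums
          (of_real (\<alpha> ^ n) * w ^ n * exp (of_real \<alpha> * cnj z * w))"
    by (intro sums_mult exp_converges)
  also have "(\<lambda>m. of_real (\<alpha> ^ n) * w ^ n * ((of_real \<alpha> * cnj z * w) ^ m /\<^sub>R fact m)) = (\<lambda>m. ?g (m + n))"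
    by (simp add: fun_eq_iff scaleR_conv_of_real power_add power_mult_distrib field_simps)
  finally have "?g sums (of_real (\<alpha> ^ n) * w ^ n * exp (of_real \<alpha> * cnj z * w) + (\<Sum>k<n. ?g k))"
    by (rule sums_iff_shift[THEN iffD1])
  thus ?thesis by (simp add: fock_extremal_def mult_ac)
qed

lemma fock_extremal_holomorphic: "fock_extremal \<alpha> n z holomorphic_on UNIV"
  by (rule entire_of_sums[OF fock_extremal_sums])

lemma taylor_coeff_fock_extremal:
  "taylor_coeff (fock_extremal \<alpha> n z) k =
     (if k < n then 0 else of_real (\<alpha> ^ n) * (of_real \<alpha> * cnj z) ^ (k - n) / fact (k - n))"
  by (rule taylor_coeff_unique[OF fock_extremal_sums])

lemma taylor0_fock_extremal: "taylor0 n (fock_extremal \<alpha> n z) w = 0"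
  unfolding taylor0_def
  by (intro sum.neutral) (simp add: taylor_coeff_fock_extremal flip: taylor_coeff_def)

text \<open>The conjugate in the extremal function pairs with \<open>z\<close> to give |z|^2, so all
  terms of the derivative series at \<open>z\<close> are nonnegative reals when \<alpha> > 0. This
  is the equality case of Cauchy-Schwarz.\<close>

lemma fock_extremal_higher_deriv_term:
  "taylor_coeff (fock_extremal \<alpha> n z) (m + n) * (fact (m + n) / fact m) * z ^ m =
     of_real (fock_const_term \<alpha> n (\<alpha> * (cmod z)\<^sup>2) m)"
proof -
  have "of_real \<alpha> * cnj z * z = complex_of_real (\<alpha> * (cmod z)\<^sup>2)"
    by (simp only: of_real_mult complex_norm_square mult_ac)
  hence "(of_real \<alpha> * cnj z) ^ m * z ^ m = complex_of_real ((\<alpha> * (cmod z)\<^sup>2) ^ m)"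
    by (simp only: power_mult_distrib[symmetric] of_real_power)
  thus ?thesis
    by (simp add: taylor_coeff_fock_extremal fock_const_term_def power2_eq_square)
qed

text \<open>The terms match through (n + m)! = n! (1 + n)_m, the splitting of the Pochhammer symbol
  at 1.\<close>

lemma fock_const_term_sums_kummer:
  assumes \<alpha>: "\<alpha> > 0"
  shows "fock_const_term \<alpha> n (\<alpha> * (cmod z)\<^sup>2) sums
           (\<alpha> ^ n * Gamma (1 + real n) * kummer_1F1 (1 + real n) 1 (\<alpha> * (cmod z)\<^sup>2))"
proof -
  define x where "x = \<alpha> * (cmod z)\<^sup>2"
  \<comment> \<open>Convergence is inherited from the power series of the \<open>n\<close>-th
    derivative of the entire extremal function at \<open>z\<close>.\<close>
  have "summable (\<lambda>m. complex_of_real (fock_const_term \<alpha> n x m))"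
    using sums_summable[OF higher_deriv_sums[OF fock_extremal_holomorphic[of \<alpha> n z], of n z]]
    by (simp only: fock_extremal_higher_deriv_term x_def)
  hence summ: "summable (fock_const_term \<alpha> n x)"
    by (simp only: summable_complex_of_real)
  define u where "u = (\<lambda>m. pochhammer (1 + real n) m / pochhammer 1 m * (x ^ m / fact m))"
  have u: "fock_const_term \<alpha> n x m = (\<alpha> ^ n * fact n) * u m" for m
  proof -
    have "pochhammer 1 (n + m) = pochhammer 1 n * pochhammer (1 + real n) m"
      by (rule pochhammer_product')
    hence "fact (n + m) = fact n * pochhammer (1 + real n) m"
      by (simp add: pochhammer_fact[symmetric])
    thus ?thesis
      by (simp add: fock_const_term_def u_def pochhammer_fact[symmetric] power2_eq_square add.commute)
  qed
  have "summable u"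
    using summ \<alpha> unfolding u[abs_def] by (subst (asm) summable_cmult_iff) auto
  hence "fock_const_term \<alpha> n x sums (\<alpha> ^ n * fact n * suminf u)"
    unfolding u[abs_def] by (intro sums_mult summable_sums)
  thus ?thesis
    by (simp add: kummer_1F1_def u_def x_def Gamma_fact add.commute)
qed

text \<open>The radicand of \<open>fock_const\<close> is positive because its leading term is
  \<alpha>^n n!, also at \<open>z = 0\<close>. So squaring undoes the root, and the constant may be
  cancelled in the sharpness argument.\<close>

lemma
  assumes \<alpha>: "\<alpha> > 0"
  shows fock_const_pos: "fock_const \<alpha> n z > 0"
    and fock_const_term_sums: "fock_const_term \<alpha> n (\<alpha> * (cmod z)\<^sup>2) sums (fock_const \<alpha> n z)\<^sup>2"
proof -
  let ?K = "\<alpha> ^ n * Gamma (1 + real n) * kummer_1F1 (1 + real n) 1 (\<alpha> * (cmod z)\<^sup>2)"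
  have "fock_const_term \<alpha> n (\<alpha> * (cmod z)\<^sup>2) m \<ge> 0" for m
    using \<alpha> by (simp add: fock_const_term_def)
  moreover have "fock_const_term \<alpha> n (\<alpha> * (cmod z)\<^sup>2) 0 > 0"
    using \<alpha> by (simp add: fock_const_term_def)
  ultimately have "?K > 0"
    using suminf_pos2[of "fock_const_term \<alpha> n (\<alpha> * (cmod z)\<^sup>2)" 0] fock_const_term_sums_kummer[OF \<alpha>, of n z]
    by (simp add: sums_iff)
  thus "fock_const \<alpha> n z > 0" and "fock_const_term \<alpha> n (\<alpha> * (cmod z)\<^sup>2) sums (fock_const \<alpha> n z)\<^sup>2"
    using fock_const_term_sums_kummer[OF \<alpha>, of n z] by (simp_all only: fock_const_def real_sqrt_gt_0_iff real_sqrt_pow2 less_imp_le)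
qed

lemma higher_deriv_fock_extremal:
  assumes \<alpha>: "\<alpha> > 0"
  shows "(deriv ^^ n) (fock_extremal \<alpha> n z) z = of_real ((fock_const \<alpha> n z)\<^sup>2)"
  using higher_deriv_sums[OF fock_extremal_holomorphic[of \<alpha> n z], of n z]
    sums_of_real[OF fock_const_term_sums[OF \<alpha>, of n z], where 'a = complex]
  unfolding fock_extremal_higher_deriv_term by (rule sums_unique2)

text \<open>After \<open>n\<close> vanishing terms, the norm series of the extremal function runs
  through the same terms as its \<open>n\<close>-th derivative at \<open>z\<close>. That derivative
  is therefore the square of the norm.\<close>

lemma
  assumes \<alpha>: "\<alpha> > 0"
  shows fock_extremal_in_fock_space: "fock_extremal \<alpha> n z \<in> fock_space \<alpha>"
    and fock_norm_extremal: "fock_norm \<alpha> (fock_extremal \<alpha> n z) = fock_const \<alpha> n z"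
proof -
  have "fock_term \<alpha> (fock_extremal \<alpha> n z) (m + n) = fock_const_term \<alpha> n (\<alpha> * (cmod z)\<^sup>2) m" for m
    using \<alpha> by (simp add: fock_term_def taylor_coeff_fock_extremal fock_const_term_def norm_mult norm_divide
        norm_power power_mult_distrib power_divide power_add field_simps power2_eq_square)
  hence "(\<lambda>m. fock_term \<alpha> (fock_extremal \<alpha> n z) (m + n)) sums (fock_const \<alpha> n z)\<^sup>2"
    using fock_const_term_sums[OF \<alpha>, of n z] by simp
  hence "fock_term \<alpha> (fock_extremal \<alpha> n z) sums 
      ((fock_const \<alpha> n z)\<^sup>2 + (\<Sum>k<n. fock_term \<alpha> (fock_extremal \<alpha> n z) k))"
    by (rule sums_iff_shift[THEN iffD1])
  also have "(\<Sum>k<n. fock_term \<alpha> (fock_extremal \<alpha> n z) k) = 0"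
    using \<alpha> by (intro sum.neutral) (simp add: fock_term_def taylor_coeff_fock_extremal)
  finally have s: "fock_term \<alpha> (fock_extremal \<alpha> n z) sums (fock_const \<alpha> n z)\<^sup>2" by simp
  thus mem: "fock_extremal \<alpha> n z \<in> fock_space \<alpha>"
    by (auto simp: fock_space_iff[OF \<alpha>] fock_extremal_holomorphic sums_iff)
  show "fock_norm \<alpha> (fock_extremal \<alpha> n z) = fock_const \<alpha> n z"
    using s fock_const_pos[OF \<alpha>, of n z] unfolding fock_norm_eq[OF \<alpha> mem] by (simp add: sums_iff)
qed

subsection \<open>The estimates\<close>

text \<open>The finite inequality bounds every partial sum by the full square sums, and the bound
  passes to the limit.\<close>

lemma norm_sums_le_Cauchy_Schwarz:
  fixes x y :: "nat \<Rightarrow> real" and c :: "nat \<Rightarrow> 'a::real_normed_vector"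
  assumes c: "c sums s" and cxy: "\<And>m. norm (c m) \<le> \<bar>x m\<bar> * \<bar>y m\<bar>"
    and x: "summable (\<lambda>m. (x m)\<^sup>2)" and y: "summable (\<lambda>m. (y m)\<^sup>2)"
  shows "norm s \<le> sqrt (\<Sum>m. (x m)\<^sup>2) * sqrt (\<Sum>m. (y m)\<^sup>2)"
proof (rule LIMSEQ_le_const2)
  show "(\<lambda>N. norm (\<Sum>m<N. c m)) \<longlonglongrightarrow> norm s"
    using c by (intro tendsto_norm) (simp add: sums_def)
  have "norm (\<Sum>m<N. c m) \<le> sqrt (\<Sum>m. (x m)\<^sup>2) * sqrt (\<Sum>m. (y m)\<^sup>2)" for N
  proof -
    have "norm (\<Sum>m<N. c m) \<le> (\<Sum>m<N. \<bar>x m\<bar> * \<bar>y m\<bar>)"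
      by (intro sum_norm_le cxy)
    also have "\<dots> \<le> L2_set x {..<N} * L2_set y {..<N}" by (rule L2_set_mult_ineq)
    also have "\<dots> \<le> sqrt (\<Sum>m. (x m)\<^sup>2) * sqrt (\<Sum>m. (y m)\<^sup>2)"
      unfolding L2_set_def using x y
      by (intro mult_mono real_sqrt_le_mono sum_le_suminf) (auto intro!: suminf_nonneg sum_nonneg)
    finally show ?thesis .
  qed
  thus "\<exists>N. \<forall>n\<ge>N. norm (\<Sum>m<n. c m) \<le> sqrt (\<Sum>m. (x m)\<^sup>2) * sqrt (\<Sum>m. (y m)\<^sup>2)" by blast
qed

lemma higher_deriv_le_fock_norm_remainder:
  assumes \<alpha>: "\<alpha> > 0" and f: "f \<in> fock_space \<alpha>"
  shows "cmod ((deriv ^^ n) f z) \<le> fock_const \<alpha> n z * fock_norm \<alpha> (\<lambda>w. f w - taylor0 n f w)"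
proof -
  have hol: "f holomorphic_on UNIV"
    using f \<alpha> by (auto simp: fock_space_iff)
  define g where "g = (\<lambda>w. f w - taylor0 n f w)"
  have g: "g \<in> fock_space \<alpha>"
    unfolding g_def taylor0_eq_poly by (rule diff_poly_in_fock_space[OF \<alpha> f])
  have tg: "taylor_coeff g k = (if k < n then 0 else taylor_coeff f k)" for k
    unfolding g_def by (rule taylor_coeff_remainder[OF hol])
  \<comment> \<open>The \<open>m\<close>-th term of the derivative series is split so that
    \<open>x\<close> carries the constant and \<open>y\<close> the norm of the remainder; the powers
    of \<alpha> cancel and the factorials combine to ((m + n)!/m!)^2 in the product of
    squares.\<close>
  define x where "x = (\<lambda>m. sqrt (fock_const_term \<alpha> n (\<alpha> * (cmod z)\<^sup>2) m))"
  define y where "y = (\<lambda>m. sqrt (fock_term \<alpha> g (m + n)))"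
  have x2: "(x m)\<^sup>2 = fock_const_term \<alpha> n (\<alpha> * (cmod z)\<^sup>2) m" for m
    using \<alpha> by (simp add: x_def fock_const_term_def)
  have y2: "(y m)\<^sup>2 = fock_term \<alpha> g (m + n)" for m
    using \<alpha> by (simp add: y_def fock_term_nonneg)
  have sg: "summable (fock_term \<alpha> g)" using g by (simp add: fock_space_iff[OF \<alpha>])
  have "cmod ((deriv ^^ n) f z) \<le> sqrt (\<Sum>m. (x m)\<^sup>2) * sqrt (\<Sum>m. (y m)\<^sup>2)"
  proof (rule norm_sums_le_Cauchy_Schwarz[OF higher_deriv_sums[OF hol]])
    show "summable (\<lambda>m. (x m)\<^sup>2)" unfolding x2 using fock_const_term_sums[OF \<alpha>] by (simp add: sums_iff)
    show "summable (\<lambda>m. (y m)\<^sup>2)" unfolding y2 using sg by (simp only: summable_iff_shift)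
    show "cmod (taylor_coeff f (m + n) * (fact (m + n) / fact m) * z ^ m) \<le> \<bar>x m\<bar> * \<bar>y m\<bar>" for m
    proof (rule power2_le_imp_le)
      have "(\<bar>x m\<bar> * \<bar>y m\<bar>)\<^sup>2 = fock_const_term \<alpha> n (\<alpha> * (cmod z)\<^sup>2) m * fock_term \<alpha> g (m + n)"
        by (simp add: power_mult_distrib x2 y2)
      also have "\<dots> = (cmod (taylor_coeff f (m + n) * (fact (m + n) / fact m) * z ^ m))\<^sup>2"
        using \<alpha> by (simp add: fock_const_term_def fock_term_def tg norm_mult norm_divide norm_power
            power_mult_distrib power_divide power_add field_simps power2_eq_square)
      finally show "(cmod (taylor_coeff f (m + n) * (fact (m + n) / fact m) * z ^ m))\<^sup>2 \<le> (\<bar>x m\<bar> * \<bar>y m\<bar>)\<^sup>2"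
        by simp
    qed simp
  qed
  also have "(\<Sum>m. (x m)\<^sup>2) = (fock_const \<alpha> n z)\<^sup>2"
    unfolding x2 using fock_const_term_sums[OF \<alpha>] by (simp add: sums_iff)
  \<comment> \<open>The first \<open>n\<close> terms for \<open>g\<close> are zero, so the shifted
    sum is the whole squared norm.\<close>
  also have "(\<Sum>m. (y m)\<^sup>2) = (\<Sum>k. fock_term \<alpha> g k)"
    using suminf_minus_initial_segment[OF sg, of n] \<alpha>
    by (simp add: y2 fock_term_def tg)
  finally show ?thesis
    using fock_const_pos[OF \<alpha>, of n z] by (simp add: fock_norm_eq[OF \<alpha> g] flip: g_def)
qed

text \<open>Since (2)_m = (m + 1)!, the terms are (m + 1) x^m/m!. The summand without the factor
  \<open>m\<close> gives e^x, and the one with it gives x e^x after an index shift.\<close>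

lemma kummer_1F1_2_1: "kummer_1F1 2 1 x = (1 + x) * exp x"
proof -
  have p: "pochhammer 2 m = (fact (Suc m) :: real)" for m
    using pochhammer_product'[of "1::real" 1 m] by (simp add: pochhammer_fact del: fact_Suc)
  have e: "(\<lambda>m. x ^ m / fact m) sums exp x"
    using exp_converges[of x] by (simp add: field_simps)
  have "(\<lambda>m. real (Suc m) * (x ^ Suc m / fact (Suc m))) = (\<lambda>m. x * (x ^ m / fact m))"
    by (simp add: fun_eq_iff)
  hence "(\<lambda>m. real (Suc m) * (x ^ Suc m / fact (Suc m))) sums (x * exp x)"
    using sums_mult[OF e, of x] by simp
  hence "(\<lambda>m. real m * (x ^ m / fact m)) sums (x * exp x)"
    by (subst (asm) sums_Suc_iff) simp
  from sums_add[OF e this]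
  have "(\<lambda>m. pochhammer 2 m / pochhammer 1 m * (x ^ m / fact m)) sums ((1 + x) * exp x)"
    by (simp add: p pochhammer_fact[symmetric] algebra_simps add_divide_distrib)
  thus ?thesis by (simp add: kummer_1F1_def sums_iff)
qed

lemma fock_const_1:
  "fock_const \<alpha> 1 z = sqrt (\<alpha> * (1 + \<alpha> * (cmod z)\<^sup>2)) * exp (\<alpha> * (cmod z)\<^sup>2 / 2)"
proof -
  have "sqrt (exp (\<alpha> * (cmod z)\<^sup>2)) = exp (\<alpha> * (cmod z)\<^sup>2 / 2)"
    by (rule real_sqrt_unique) (simp_all flip: exp_double)
  moreover have "Gamma 2 = (1 :: real)" using Gamma_fact[of 1, where 'a = real] by simp
  ultimately show ?thesis
    by (simp add: fock_const_def kummer_1F1_2_1 real_sqrt_mult)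
qed

text \<open>Sharpness is expressed pointwise in \<open>z\<close>, as minimality of the constant
  among all \<open>C\<close> valid on the whole space; testing on the extremal function settles all
  three such claims.\<close>

theorem theorem2p3:
  fixes \<alpha> :: real and n :: nat
  assumes "\<alpha> > 0" and "n \<ge> 1"
  shows
    "(\<forall>f\<in>fock_space \<alpha>. \<forall>z.
        cmod ((deriv ^^ n) f z) \<le> fock_const \<alpha> n z * fock_norm \<alpha> (\<lambda>w. f w - taylor0 n f w))
   \<and> (\<forall>z C. (\<forall>f\<in>fock_space \<alpha>.
          cmod ((deriv ^^ n) f z) \<le> C * fock_norm \<alpha> (\<lambda>w. f w - taylor0 n f w))
        \<longrightarrow> fock_const \<alpha> n z \<le> C)
   \<and> (\<forall>z. fock_extremal \<alpha> n z \<in> fock_space \<alpha> \<and>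
        cmod ((deriv ^^ n) (fock_extremal \<alpha> n z) z) =
          fock_const \<alpha> n z *
            fock_norm \<alpha> (\<lambda>w. fock_extremal \<alpha> n z w - taylor0 n (fock_extremal \<alpha> n z) w))
   \<and> (\<forall>f\<in>fock_space \<alpha>. \<forall>z.
        cmod ((deriv ^^ n) f z) \<le>
          fock_const \<alpha> n z *
            (INF p\<in>{p :: complex poly. degree p \<le> n - 1}. fock_norm \<alpha> (\<lambda>w. f w - poly p w)))
   \<and> (\<forall>f\<in>fock_space \<alpha>. \<forall>z.
        cmod (deriv f z) \<le>
          sqrt (\<alpha> * (1 + \<alpha> * (cmod z)\<^sup>2)) * exp (\<alpha> * (cmod z)\<^sup>2 / 2) *
            fock_norm \<alpha> (\<lambda>w. f w - f 0) \<and>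
        sqrt (\<alpha> * (1 + \<alpha> * (cmod z)\<^sup>2)) * exp (\<alpha> * (cmod z)\<^sup>2 / 2) *
            fock_norm \<alpha> (\<lambda>w. f w - f 0) \<le>
          sqrt (\<alpha> * (1 + \<alpha> * (cmod z)\<^sup>2)) * exp (\<alpha> * (cmod z)\<^sup>2 / 2) * fock_norm \<alpha> f)
   \<and> (\<forall>z C. (\<forall>f\<in>fock_space \<alpha>. cmod (deriv f z) \<le> C * fock_norm \<alpha> (\<lambda>w. f w - f 0))
        \<longrightarrow> sqrt (\<alpha> * (1 + \<alpha> * (cmod z)\<^sup>2)) * exp (\<alpha> * (cmod z)\<^sup>2 / 2) \<le> C)
   \<and> (\<forall>z C. (\<forall>f\<in>fock_space \<alpha>. cmod (deriv f z) \<le> C * fock_norm \<alpha> f)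
        \<longrightarrow> sqrt (\<alpha> * (1 + \<alpha> * (cmod z)\<^sup>2)) * exp (\<alpha> * (cmod z)\<^sup>2 / 2) \<le> C)"
proof (intro conjI ballI allI impI; (unfold fock_const_1[symmetric])?)
  have \<alpha>: "\<alpha> > 0" by fact
  have taylor1: "taylor0 1 f = (\<lambda>w. f 0)" for f
    by (simp add: taylor0_def fun_eq_iff)
  \<comment> \<open>On the extremal function derivative and norm are the square and the first power
    of the constant, so any valid \<open>C\<close> satisfies K^2 \<le> C K with K > 0.\<close>
  have extremal: "fock_const \<alpha> k z \<le> C"
    if "cmod ((deriv ^^ k) (fock_extremal \<alpha> k z) z) \<le> C * fock_norm \<alpha> (fock_extremal \<alpha> k z)" for k z C
  proof -
    have "(fock_const \<alpha> k z)\<^sup>2 \<le> C * fock_const \<alpha> k z"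
      using that by (simp add: higher_deriv_fock_extremal[OF \<alpha>] fock_norm_extremal[OF \<alpha>] norm_power)
    thus ?thesis
      using fock_const_pos[OF \<alpha>, of k z] by (simp add: power2_eq_square)
  qed
  fix z
  show "fock_extremal \<alpha> n z \<in> fock_space \<alpha>"
    by (rule fock_extremal_in_fock_space[OF \<alpha>])
  show "cmod ((deriv ^^ n) (fock_extremal \<alpha> n z) z) =
          fock_const \<alpha> n z *
            fock_norm \<alpha> (\<lambda>w. fock_extremal \<alpha> n z w - taylor0 n (fock_extremal \<alpha> n z) w)"
    by (simp add: taylor0_fock_extremal higher_deriv_fock_extremal[OF \<alpha>] fock_norm_extremal[OF \<alpha>] norm_power)
       (simp add: power2_eq_square)
  {
    fix f assume f: "f \<in> fock_space \<alpha>"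
    show 1: "cmod ((deriv ^^ n) f z) \<le> fock_const \<alpha> n z * fock_norm \<alpha> (\<lambda>w. f w - taylor0 n f w)"
      by (rule higher_deriv_le_fock_norm_remainder[OF \<alpha> f])
    \<comment> \<open>The remainder norm is a lower bound for the family. As
      \<open>n \<ge> 1\<close>, the subtraction \<open>n - 1\<close> is not truncated and the degree
      condition makes all coefficients from \<open>n\<close> on vanish.\<close>
    have "fock_norm \<alpha> (\<lambda>w. f w - taylor0 n f w) \<le>
        (INF p\<in>{p :: complex poly. degree p \<le> n - 1}. fock_norm \<alpha> (\<lambda>w. f w - poly p w))"
    proof (rule cINF_greatest)
      show "{p :: complex poly. degree p \<le> n - 1} \<noteq> {}"
        by (auto intro!: exI[of _ 0])
      show "fock_norm \<alpha> (\<lambda>w. f w - taylor0 n f w) \<le> fock_norm \<alpha> (\<lambda>w. f w - poly p w)"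
        if "p \<in> {p. degree p \<le> n - 1}" for p
        using that \<open>n \<ge> 1\<close> by (intro fock_norm_remainder_le[OF \<alpha> f] coeff_eq_0) auto
    qed
    with 1 show "cmod ((deriv ^^ n) f z) \<le> fock_const \<alpha> n z *
            (INF p\<in>{p :: complex poly. degree p \<le> n - 1}. fock_norm \<alpha> (\<lambda>w. f w - poly p w))"
      using fock_const_pos[OF \<alpha>, of n z] by (meson mult_left_mono less_imp_le order_trans)
    show "cmod (deriv f z) \<le> fock_const \<alpha> 1 z * fock_norm \<alpha> (\<lambda>w. f w - f 0)"
      using higher_deriv_le_fock_norm_remainder[OF \<alpha> f, of 1 z] by (simp add: taylor1[simplified])
    \<comment> \<open>The second estimate compares the constant term of \<open>f\<close> with the
      zero polynomial as competitor.\<close>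
    show "fock_const \<alpha> 1 z * fock_norm \<alpha> (\<lambda>w. f w - f 0) \<le> fock_const \<alpha> 1 z * fock_norm \<alpha> f"
      using fock_norm_remainder_le[OF \<alpha> f, of 1 0] fock_const_pos[OF \<alpha>, of 1 z]
      by (simp add: taylor1[simplified])
  }
  fix C
  show "fock_const \<alpha> n z \<le> C"
    if "\<forall>f\<in>fock_space \<alpha>. cmod ((deriv ^^ n) f z) \<le> C * fock_norm \<alpha> (\<lambda>w. f w - taylor0 n f w)"
    using that[rule_format, OF fock_extremal_in_fock_space[OF \<alpha>, of n z]]
    by (intro extremal) (simp add: taylor0_fock_extremal)
  \<comment> \<open>For \<open>n = 1\<close> the extremal function vanishes at 0, so subtracting its
    value there changes nothing and it serves both norms.\<close>
  have ext0: "fock_extremal \<alpha> 1 z 0 = 0" by (simp add: fock_extremal_def)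
  show "fock_const \<alpha> 1 z \<le> C"
    if "\<forall>f\<in>fock_space \<alpha>. cmod (deriv f z) \<le> C * fock_norm \<alpha> (\<lambda>w. f w - f 0)"
    using that[rule_format, OF fock_extremal_in_fock_space[OF \<alpha>, of 1 z]]
    by (intro extremal) (simp add: ext0[simplified])
  show "fock_const \<alpha> 1 z \<le> C"
    if "\<forall>f\<in>fock_space \<alpha>. cmod (deriv f z) \<le> C * fock_norm \<alpha> f"
    using that[rule_format, OF fock_extremal_in_fock_space[OF \<alpha>, of 1 z]]
    by (intro extremal) simp
qed

end
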